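(* Let $f:\mathbb{R}^{n+m}\to\mathbb{R}$ be a $C^2$ function such that $\nabla f$ is globally Lipschitz with constant $L>0$ and $\nabla^2 f(z^\ast)$ is invertible at every saddle point $z^\ast$ of $f$. Let $\tau>0$, $0<\gamma<2$ and, for $s>0$, let $w_s(z)=z-\gamma s\Lambda_\tau F(z-s\Lambda_\tau F(z))$ (the Generalised Extragradient method) and $W_s(z)=\big(-I+(1-\tfrac{\gamma}{2})s\Lambda_\tau\nabla F(z)\big)\gamma\Lambda_\tau F(z)$ (its $O(s)$-resolution vector field). Assume that $w_s$ and $W_s$ are $C^1$ and satisfy the one-step consistency condition: there is an integer $r\ge2$ such that for every $z_0\in\mathbb{R}^{n+m}$, $|Z(s;z_0)-w_s(z_0)|\le O(s^r)$, where $Z(s;z_0)$ is the solution of $\dot Z=W_s(Z)$ at time $s$ with $Z(0)=z_0$. Then there exists $s^\ast>0$ such that for all $s\in(0,s^\ast)$, the set of saddle points of $f$ is a subset of the set of exponentially stable equilibria of $z_{k+1}=z_k-\gamma s\Lambda_\tau F(z_k-s\Lambda_\tau F(z_k))$.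
   Context: Write $z=(x,y)\in\mathbb{R}^n\times\mathbb{R}^m$. A (local) saddle point of $f$ is a point $(x^\ast,y^\ast)$ having a neighbourhood $U$ such that $f(x^\ast,y)\le f(x^\ast,y^\ast)\le f(x,y^\ast)$ for all $(x,y)\in U$. Notation: $F(z)=\begin{bmatrix}\nabla_x f(z)\\-\nabla_y f(z)\end{bmatrix}$, $\nabla F$ is the Jacobian matrix of $F$, $\Lambda_\tau=\begin{bmatrix}\frac1\tau I&0\\0&I\end{bmatrix}$ (blocks of sizes $n$ and $m$). In the algorithm's terms, $\hat x_k=x_k-\alpha_{1x}\nabla_xf(x_k,y_k)$, $\hat y_k=y_k+\alpha_{1y}\nabla_yf(x_k,y_k)$, $x_{k+1}=x_k-\alpha_{2x}\nabla_xf(\hat x_k,\hat y_k)$, $y_{k+1}=y_k+\alpha_{2y}\nabla_yf(\hat x_k,\hat y_k)$ with $\gamma=\alpha_{2x}/\alpha_{1x}=\alpha_{2y}/\alpha_{1y}$, $\tau=\alpha_{1y}/\alpha_{1x}=\alpha_{2y}/\alpha_{2x}$, $s=\alpha_{1y}$. "$\le O(s^r)$" means: for the given $z_0$ there are $C\ge0$, $s_0>0$ with the left-hand side at most $Cs^r$ for all $s\in(0,s_0]$. An equilibrium (fixed point) $z^e$ of $z_{k+1}=w_s(z_k)$ is exponentially stable (meant locally) if it is stable (for every $\varepsilon>0$ there is $\delta>0$ such that $|z_0-z^e|<\delta$ implies $|z_k-z^e|<\varepsilon$ for all $k\ge0$) and there exist $\delta>0$, $M>0$, $q\in(0,1)$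 such that $|z_0-z^e|<\delta$ implies $|z_k-z^e|\le M|z_0-z^e|q^k$ for all $k\ge0$. *)

theory Defs
  imports "HOL-Analysis.Analysis"
begin

text \<open>
  A point \<open>z = (x, y)\<close> of \<open>R^n \<times> R^m\<close> is a vector indexed by the sum type, so that Jacobians and
  \<open>\<Lambda>\<^sub>\<tau>\<close> are square matrices of size \<open>n + m\<close>; \<open>Inl\<close> indexes the \<open>x\<close>-block and \<open>Inr\<close> the \<open>y\<close>-block.
\<close>

definition xpart :: "real^('n::finite + 'm::finite) \<Rightarrow> real^'n" where
  "xpart z = (\<chi> i. z $ Inl i)"

definition ypart :: "real^('n::finite + 'm::finite) \<Rightarrow> real^'m" where
  "ypart z = (\<chi> j. z $ Inr j)"

definition join :: "real^'n \<Rightarrow> real^'m \<Rightarrow> real^('n::finite + 'm::finite)" where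
  "join x y = (\<chi> k. case k of Inl i \<Rightarrow> x $ i | Inr j \<Rightarrow> y $ j)"

definition gradient :: "('a::real_inner \<Rightarrow> real) \<Rightarrow> 'a \<Rightarrow> 'a" where
  "gradient f z = (THE D. GDERIV f z :> D)"

definition gradient_x :: "(real^('n::finite + 'm::finite) \<Rightarrow> real) \<Rightarrow> real^('n::finite + 'm::finite) \<Rightarrow> real^'n" where
  "gradient_x f z = gradient (\<lambda>x. f (join x (ypart z))) (xpart z)"

definition gradient_y :: "(real^('n::finite + 'm::finite) \<Rightarrow> real) \<Rightarrow> real^('n::finite + 'm::finite) \<Rightarrow> real^'m" where
  "gradient_y f z = gradient (\<lambda>y. f (join (xpart z) y)) (ypart z)"

definition hessian :: "(real^'k \<Rightarrow> real) \<Rightarrow> real^'k \<Rightarrow> real^'k^'k" where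
  "hessian f z = jacobian (gradient f) (at z)"

definition C1 :: "('a::real_normed_vector \<Rightarrow> 'b::real_normed_vector) \<Rightarrow> bool" where
  "C1 g \<longleftrightarrow> (\<exists>g' :: 'a \<Rightarrow> 'a \<Rightarrow>\<^sub>L 'b.
     (\<forall>z. (g has_derivative blinfun_apply (g' z)) (at z)) \<and> continuous_on UNIV g')"

definition C2 :: "('a::real_normed_vector \<Rightarrow> 'b::real_normed_vector) \<Rightarrow> bool" where
  "C2 g \<longleftrightarrow> (\<exists>g' :: 'a \<Rightarrow> 'a \<Rightarrow>\<^sub>L 'b.
     (\<forall>z. (g has_derivative blinfun_apply (g' z)) (at z)) \<and> C1 g')"

definition saddle_point :: "(real^('n::finite + 'm::finite) \<Rightarrow> real) \<Rightarrow> real^('n::finite + 'm::finite) \<Rightarrow> bool" where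
  "saddle_point f z \<longleftrightarrow> (\<exists>U. open U \<and> z \<in> U \<and>
     (\<forall>x y. join x y \<in> U \<longrightarrow> f (join (xpart z) y) \<le> f z \<and> f z \<le> f (join x (ypart z))))"

definition Fmap :: "(real^('n::finite + 'm::finite) \<Rightarrow> real) \<Rightarrow> real^('n::finite + 'm::finite) \<Rightarrow> real^('n::finite + 'm::finite)" where
  "Fmap f z = join (gradient_x f z) (- gradient_y f z)"

definition Lam :: "real \<Rightarrow> real^('n::finite + 'm::finite)^('n::finite + 'm::finite)" where
  "Lam \<tau> = (\<chi> k l. if k = l then (case k of Inl _ \<Rightarrow> 1 / \<tau> | Inr _ \<Rightarrow> 1) else 0)"

definition gen_extragradient :: "(real^('n::finite + 'm::finite) \<Rightarrow> real) \<Rightarrow> real \<Rightarrow> real \<Rightarrow> real \<Rightarrow> real^('n::finite + 'm::finite) \<Rightarrow> real^('n::finite + 'm::finite)" where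
  "gen_extragradient f \<tau> \<gamma> s z = z - (\<gamma> * s) *\<^sub>R (Lam \<tau> *v Fmap f (z - s *\<^sub>R (Lam \<tau> *v Fmap f z)))"

definition extragradient_resolution_field :: "(real^('n::finite + 'm::finite) \<Rightarrow> real) \<Rightarrow> real \<Rightarrow> real \<Rightarrow> real \<Rightarrow> real^('n::finite + 'm::finite) \<Rightarrow> real^('n::finite + 'm::finite)" where
  "extragradient_resolution_field f \<tau> \<gamma> s z =
     (- mat 1 + ((1 - \<gamma> / 2) * s) *\<^sub>R (Lam \<tau> ** jacobian (Fmap f) (at z))) *v
       (\<gamma> *\<^sub>R (Lam \<tau> *v Fmap f z))"

definition ode_solution :: "('a::real_normed_vector \<Rightarrow> 'a) \<Rightarrow> 'a \<Rightarrow> real \<Rightarrow> (real \<Rightarrow> 'a) \<Rightarrow> bool" where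
  "ode_solution V z0 T Z \<longleftrightarrow> Z 0 = z0 \<and>
     (\<forall>t\<in>{0..T}. (Z has_vector_derivative V (Z t)) (at t within {0..T}))"

text \<open>
  \<open>|Z(s; z\<^sub>0) - w\<^sub>s(z\<^sub>0)| \<le> O(s^r)\<close> for every \<open>z\<^sub>0\<close>. Both the vector field and the time of evaluation
  depend on \<open>s\<close>, and \<open>C\<close>, \<open>s\<^sub>0\<close> may depend on \<open>z\<^sub>0\<close>. The quantifier over \<open>Z\<close> expresses
  ``the solution'': for a \<open>C\<^sup>1\<close> field of linear growth, such as \<open>W\<^sub>s\<close> when the gradient of \<open>f\<close> is
  Lipschitz, it exists on \<open>[0, s]\<close> and is unique.
\<close>

definition one_step_consistent ::
    "nat \<Rightarrow> (real \<Rightarrow> 'a::real_normed_vector \<Rightarrow> 'a) \<Rightarrow> (real \<Rightarrow> 'a \<Rightarrow> 'a) \<Rightarrow> bool" where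
  "one_step_consistent r w W \<longleftrightarrow>
     (\<forall>z0. \<exists>C\<ge>0. \<exists>s0>0. \<forall>s\<in>{0<..s0}. \<forall>Z.
        ode_solution (W s) z0 s Z \<longrightarrow> norm (Z s - w s z0) \<le> C * s ^ r)"

definition stable_equilibrium :: "('a::real_normed_vector \<Rightarrow> 'a) \<Rightarrow> 'a \<Rightarrow> bool" where
  "stable_equilibrium w ze \<longleftrightarrow> w ze = ze \<and>
     (\<forall>\<epsilon>>0. \<exists>\<delta>>0. \<forall>z0. norm (z0 - ze) < \<delta> \<longrightarrow> (\<forall>k. norm ((w ^^ k) z0 - ze) < \<epsilon>))"

definition exp_stable_equilibrium :: "('a::real_normed_vector \<Rightarrow> 'a) \<Rightarrow> 'a \<Rightarrow> bool" where
  "exp_stable_equilibrium w ze \<longleftrightarrow> stable_equilibrium w ze \<and>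
     (\<exists>\<delta>>0. \<exists>M>0. \<exists>q\<in>{0<..<1}. \<forall>z0. norm (z0 - ze) < \<delta> \<longrightarrow>
        (\<forall>k. norm ((w ^^ k) z0 - ze) \<le> M * norm (z0 - ze) * q ^ k))"

end

theory Submission
  imports Defs
begin

text \<open>
  At a saddle point the first and second order conditions give \<open>F z = 0\<close> and, because the off-diagonal
  blocks of the symmetric Hessian enter \<open>\<nabla>F\<close> with opposite signs, \<open>\<nabla>F z\<close> is monotone. In the
  coordinates rescaled by \<open>\<Lambda>\<^sub>\<tau>\<close> to the power \<open>-1/2\<close>, the linearised method is \<open>x - \<gamma> s S (x - s S x)\<close> with \<open>S\<close> monotone,
  injective and bounded by a constant \<open>K\<close> that depends only on \<open>L\<close> and \<open>\<tau>\<close>. The classical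
  extragradient estimate shows that this map decreases the squared norm of \<open>x\<close> by at least
  \<open>\<gamma> s\<^sup>2 (2 (1 - s K) - \<gamma> (1 + s K)\<^sup>2)\<close> times the squared norm of \<open>S x\<close>, so it is a strict contraction for
  small \<open>s\<close>, with a threshold that does not depend on the saddle point.
\<close>

section \<open>Derivatives\<close>

text \<open>Comparing \<open>H (t *\<^sub>R x)\<close> with the increment of \<open>G\<close> for
  one small \<open>t\<close> and dividing by \<open>t\<close> gives the bound up to an arbitrary
  \<open>e\<close>. Applied to the gradient, it bounds every Hessian by the same \<open>L\<close>,
  so that the step-size threshold can be uniform over the saddle points.\<close>

lemma has_derivative_norm_le_lipschitz:
  fixes G :: "'a::real_normed_vector \<Rightarrow> 'b::real_normed_vector"
  assumes "L-lipschitz_on UNIV G" and der: "(G has_derivative H) (at z)"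
  shows "norm (H x) \<le> L * norm x"
proof (cases "x = 0")
  case True
  then show ?thesis using has_derivative_linear[OF der] by (simp add: linear_0)
next
  case False
  interpret H: bounded_linear H using der by (rule has_derivative_bounded_linear)
  show ?thesis
  proof (rule field_le_epsilon)
    fix e :: real assume e: "e > 0"
    \<comment> \<open>With this tolerance the linearisation error at \<open>t *\<^sub>R x\<close> is
      exactly \<open>t * e\<close>.\<close>
    define e' where "e' = e / norm x"
    have "e' > 0" using e False by (simp add: e'_def)
    then obtain d where d: "d > 0"
      "\<And>y. norm (y - z) < d \<Longrightarrow> norm (G y - G z - H (y - z)) \<le> e' * norm (y - z)"
      using der unfolding has_derivative_at_alt by blast
    define t where "t = d / (2 * norm x)"
    have t: "t > 0" using d(1) False by (simp add: t_def)
    have "norm (t *\<^sub>R x) < d" using d(1) False by (simp add: t_def)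
    then have 1: "norm (G (z + t *\<^sub>R x) - G z - H (t *\<^sub>R x)) \<le> e' * norm (t *\<^sub>R x)"
      using d(2)[of "z + t *\<^sub>R x"] by simp
    have 2: "norm (G (z + t *\<^sub>R x) - G z) \<le> L * norm (t *\<^sub>R x)"
      using lipschitz_onD[OF assms(1), of "z + t *\<^sub>R x" z] by (simp add: dist_norm)
    have "norm (H (t *\<^sub>R x)) \<le> norm (G (z + t *\<^sub>R x) - G z) + norm (G (z + t *\<^sub>R x) - G z - H (t *\<^sub>R x))"
      using norm_triangle_ineq4[of "G (z + t *\<^sub>R x) - G z" "G (z + t *\<^sub>R x) - G z - H (t *\<^sub>R x)"] by simp
    also have "\<dots> \<le> L * norm (t *\<^sub>R x) + e' * norm (t *\<^sub>R x)" using 1 2 by simp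
    also have "\<dots> = t * (L * norm x + e)" using t False by (simp add: e'_def algebra_simps)
    finally have "t * norm (H x) \<le> t * (L * norm x + e)" using t by (simp add: H.scaleR)
    then show "norm (H x) \<le> L * norm x + e" using t by simp
  qed
qed

section \<open>Restriction to lines: symmetry of the second derivative and conditions at a
  minimum\<close>

lemma DERIV_along_line:
  assumes "\<And>z. GDERIV f z :> G z"
  shows "((\<lambda>t. f (z + t *\<^sub>R u)) has_real_derivative (G (z + t *\<^sub>R u) \<bullet> u)) (at t)"
proof -
  have "((\<lambda>t. z + t *\<^sub>R u) has_derivative (\<lambda>h. h *\<^sub>R u)) (at t)"
    by (auto intro!: derivative_eq_intros)
  then have "((\<lambda>t. f (z + t *\<^sub>R u)) has_derivative (\<lambda>h. (h *\<^sub>R u) \<bullet> G (z + t *\<^sub>R u))) (at t)"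
    by (rule has_derivative_compose) (use assms in \<open>simp add: gderiv_def\<close>)
  then show ?thesis
    by (simp add: has_field_derivative_def inner_commute mult.commute[of _ "_ \<bullet> _"])
qed

text \<open>The second difference is the increment over [0, t] of \<open>\<phi>\<close>, the
  difference of \<open>f\<close> along two parallel segments in direction \<open>u\<close>. The mean
  value theorem turns it into a difference of two gradients, and both are linearised at the single
  point \<open>z\<close>, where \<open>G\<close> is differentiable.\<close>

lemma second_difference_bound:
  fixes f :: "'a::real_inner \<Rightarrow> real"
  assumes f: "\<And>z. GDERIV f z :> G z" and der: "(G has_derivative H) (at z)" and e: "e > 0"
  shows "\<exists>d>0. \<forall>t. 0 < t \<and> t < d \<longrightarrow>
    \<bar>f (z + t *\<^sub>R u + t *\<^sub>R v) - f (z + t *\<^sub>R u) - f (z + t *\<^sub>R v) + f z - t\<^sup>2 * (H v \<bullet> u)\<bar>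
      \<le> e * t\<^sup>2 * ((2 * norm u + norm v) * norm u)"
proof -
  interpret H: bounded_linear H using der by (rule has_derivative_bounded_linear)
  obtain d0 where d0: "d0 > 0"
    "\<And>y. norm (y - z) < d0 \<Longrightarrow> norm (G y - G z - H (y - z)) \<le> e * norm (y - z)"
    using der e unfolding has_derivative_at_alt by blast
  \<comment> \<open>For \<open>t * R < d0\<close> both evaluation points stay within
    \<open>d0\<close> of \<open>z\<close>; the summand 1 keeps \<open>R\<close> positive when
    \<open>u\<close> and \<open>v\<close> vanish.\<close>
  define R where "R = norm u + norm v + 1"
  have R: "R > 0" by (simp add: R_def add_nonneg_pos)
  have "\<bar>f (z + t *\<^sub>R u + t *\<^sub>R v) - f (z + t *\<^sub>R u) - f (z + t *\<^sub>R v) + f z - t\<^sup>2 * (H v \<bullet> u)\<bar>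
      \<le> e * t\<^sup>2 * ((2 * norm u + norm v) * norm u)" if t: "0 < t" "t < d0 / R" for t
  proof -
    have tR: "t * R < d0" using t R by (simp add: pos_less_divide_eq)
    define \<phi> where "\<phi> = (\<lambda>\<sigma>. f ((z + t *\<^sub>R v) + \<sigma> *\<^sub>R u) - f (z + \<sigma> *\<^sub>R u))"
    have "\<exists>\<xi>>0. \<xi> < t \<and> \<phi> t - \<phi> 0 =
        (t - 0) * (G ((z + t *\<^sub>R v) + \<xi> *\<^sub>R u) \<bullet> u - G (z + \<xi> *\<^sub>R u) \<bullet> u)"
      unfolding \<phi>_def using t by (intro MVT2 DERIV_diff DERIV_along_line f) auto
    then obtain \<xi> where \<xi>: "0 < \<xi>" "\<xi> < t"
      "\<phi> t - \<phi> 0 = t * (G ((z + t *\<^sub>R v) + \<xi> *\<^sub>R u) \<bullet> u - G (z + \<xi> *\<^sub>R u) \<bullet> u)" by auto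
    define a where "a = t *\<^sub>R v + \<xi> *\<^sub>R u"
    define b where "b = \<xi> *\<^sub>R u"
    have xu: "\<xi> * norm u \<le> t * norm u" using \<xi> by (simp add: mult_right_mono)
    have na: "norm a \<le> t * (norm u + norm v)"
      using norm_triangle_ineq[of "t *\<^sub>R v" "\<xi> *\<^sub>R u"] xu t \<xi> by (simp add: a_def algebra_simps)
    have nb: "norm b \<le> t * norm u" using xu \<xi> by (simp add: b_def)
    have "0 \<le> t * norm u" "0 \<le> t * norm v" using t by auto
    then have ad: "norm a < d0" "norm b < d0"
      using na nb tR t unfolding R_def distrib_left by linarith+
    have ea: "norm (G (z + a) - G z - H a) \<le> e * norm a" using d0(2)[of "z + a"] ad by simp
    have eb: "norm (G (z + b) - G z - H b) \<le> e * norm b" using d0(2)[of "z + b"] ad by simp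
    \<comment> \<open>The unknown mean value point \<open>\<xi>\<close> cancels here, which leaves
      the main term of order \<open>t\<^sup>2\<close>.\<close>
    have Hab: "H a - H b = t *\<^sub>R H v" by (simp add: a_def b_def H.add H.scaleR)
    have "norm (G (z + a) - G (z + b) - t *\<^sub>R H v)
        = norm ((G (z + a) - G z - H a) - (G (z + b) - G z - H b))"
      unfolding Hab[symmetric] by (simp add: algebra_simps)
    also have "\<dots> \<le> e * norm a + e * norm b"
      using ea eb norm_triangle_ineq4[of "G (z + a) - G z - H a" "G (z + b) - G z - H b"] by linarith
    also have "\<dots> = e * (norm a + norm b)" by (simp add: algebra_simps)
    also have "\<dots> \<le> e * (t * (2 * norm u + norm v))"
      using na nb e by (intro mult_left_mono) (auto simp: algebra_simps)
    finally have n: "norm (G (z + a) - G (z + b) - t *\<^sub>R H v) \<le> e * (t * (2 * norm u + norm v))" .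
    have "f (z + t *\<^sub>R u + t *\<^sub>R v) - f (z + t *\<^sub>R u) - f (z + t *\<^sub>R v) + f z - t\<^sup>2 * (H v \<bullet> u)
        = \<phi> t - \<phi> 0 - t\<^sup>2 * (H v \<bullet> u)" by (simp add: \<phi>_def algebra_simps)
    also have "\<dots> = t * ((G (z + a) - G (z + b) - t *\<^sub>R H v) \<bullet> u)"
      using \<xi>(3) by (simp add: a_def b_def inner_diff_left power2_eq_square algebra_simps)
    finally have "\<bar>f (z + t *\<^sub>R u + t *\<^sub>R v) - f (z + t *\<^sub>R u) - f (z + t *\<^sub>R v) + f z - t\<^sup>2 * (H v \<bullet> u)\<bar>
        = t * \<bar>(G (z + a) - G (z + b) - t *\<^sub>R H v) \<bullet> u\<bar>" using t by (simp add: abs_mult)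
    also have "\<dots> \<le> t * (norm (G (z + a) - G (z + b) - t *\<^sub>R H v) * norm u)"
      using t by (intro mult_left_mono Cauchy_Schwarz_ineq2) auto
    also have "\<dots> \<le> t * ((e * (t * (2 * norm u + norm v))) * norm u)"
      using t n by (intro mult_left_mono mult_right_mono) auto
    finally show ?thesis by (simp add: power2_eq_square algebra_simps)
  qed
  then show ?thesis using d0(1) R by (intro exI[of _ "d0 / R"]) auto
qed

text \<open>The second difference does not change when \<open>u\<close> and \<open>v\<close> are
  swapped, while \<open>second_difference_bound\<close> approximates it by
  \<open>t\<^sup>2 * (H v \<bullet> u)\<close> in one order and by
  \<open>t\<^sup>2 * (H u \<bullet> v)\<close> in the other, with an error that is arbitrarily small
  relative to \<open>t\<^sup>2\<close>.\<close>

lemma derivative_of_gradient_symmetric: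
  fixes f :: "'a::real_inner \<Rightarrow> real"
  assumes f: "\<And>z. GDERIV f z :> G z" and der: "(G has_derivative H) (at z)"
  shows "H u \<bullet> v = H v \<bullet> u"
proof -
  define N where "N = (2 * norm u + norm v) * norm u + (2 * norm v + norm u) * norm v"
  have N: "N \<ge> 0" by (simp add: N_def)
  have "\<bar>H u \<bullet> v - H v \<bullet> u\<bar> \<le> 0"
  proof (rule field_le_epsilon)
    fix e :: real assume e: "e > 0"
    define e' where "e' = e / (N + 1)"
    have e': "e' > 0" using e N by (simp add: e'_def)
    let ?D = "\<lambda>t. f (z + t *\<^sub>R u + t *\<^sub>R v) - f (z + t *\<^sub>R u) - f (z + t *\<^sub>R v) + f z"
    obtain d1 where d1: "d1 > 0" "\<And>t. 0 < t \<and> t < d1 \<Longrightarrow>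
        \<bar>?D t - t\<^sup>2 * (H v \<bullet> u)\<bar> \<le> e' * t\<^sup>2 * ((2 * norm u + norm v) * norm u)"
      using second_difference_bound[OF f der e', of u v] by blast
    obtain d2 where d2: "d2 > 0" "\<And>t. 0 < t \<and> t < d2 \<Longrightarrow>
        \<bar>f (z + t *\<^sub>R v + t *\<^sub>R u) - f (z + t *\<^sub>R v) - f (z + t *\<^sub>R u) + f z - t\<^sup>2 * (H u \<bullet> v)\<bar>
          \<le> e' * t\<^sup>2 * ((2 * norm v + norm u) * norm v)"
      using second_difference_bound[OF f der e', of v u] by blast
    define t where "t = min d1 d2 / 2"
    have t: "0 < t" "t < d1" "t < d2" using d1(1) d2(1) by (auto simp: t_def)
    have 1: "\<bar>?D t - t\<^sup>2 * (H v \<bullet> u)\<bar> \<le> e' * t\<^sup>2 * ((2 * norm u + norm v) * norm u)"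
      using d1(2)[of t] t by simp
    have sw: "z + t *\<^sub>R v + t *\<^sub>R u = z + t *\<^sub>R u + t *\<^sub>R v" by (simp add: algebra_simps)
    have 2: "\<bar>?D t - t\<^sup>2 * (H u \<bullet> v)\<bar> \<le> e' * t\<^sup>2 * ((2 * norm v + norm u) * norm v)"
      using d2(2)[of t] t unfolding sw by (simp add: algebra_simps)
    have "\<bar>t\<^sup>2 * (H u \<bullet> v) - t\<^sup>2 * (H v \<bullet> u)\<bar> \<le> e' * t\<^sup>2 * ((2 * norm u + norm v) * norm u) 
      + e' * t\<^sup>2 * ((2 * norm v + norm u) * norm v)"
      using 1 2 by linarith
    then have "t\<^sup>2 * \<bar>H u \<bullet> v - H v \<bullet> u\<bar> \<le> t\<^sup>2 * (e' * N)"
      unfolding N_def right_diff_distrib[symmetric] abs_mult by (simp add: algebra_simps)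
    then have "\<bar>H u \<bullet> v - H v \<bullet> u\<bar> \<le> e' * N" using t by simp
    also have "\<dots> \<le> e' * (N + 1)" using e' by simp
    also have "\<dots> = e" using N by (simp add: e'_def)
    finally show "\<bar>H u \<bullet> v - H v \<bullet> u\<bar> \<le> 0 + e" by simp
  qed
  then show ?thesis by simp
qed

text \<open>Fermat's rule makes the slope along the line vanish at 0. If the curvature were
  negative, the slope would be negative just to the right of 0, and the mean value theorem would
  produce a value below \<open>f z\<close>.\<close>

lemma local_min_along_line_conditions:
  fixes f :: "'a::real_inner \<Rightarrow> real"
  assumes f: "\<And>z. GDERIV f z :> G z" and der: "(G has_derivative H) (at z)"
    and d: "d > 0" and min: "\<And>t. \<bar>t\<bar> < d \<Longrightarrow> f z \<le> f (z + t *\<^sub>R u)"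
  shows "G z \<bullet> u = 0" "H u \<bullet> u \<ge> 0"
proof -
  let ?\<phi> = "\<lambda>t. f (z + t *\<^sub>R u)"
  have D: "(?\<phi> has_real_derivative (G (z + t *\<^sub>R u) \<bullet> u)) (at t)" for t
    using DERIV_along_line[OF f] .
  show G0: "G z \<bullet> u = 0"
    using DERIV_local_min[OF D[of 0] d] min by simp
  interpret H: bounded_linear H using der by (rule has_derivative_bounded_linear)
  have "((\<lambda>t. z + t *\<^sub>R u) has_derivative (\<lambda>h. h *\<^sub>R u)) (at 0)"
    by (auto intro!: derivative_eq_intros)
  then have "((\<lambda>t. G (z + t *\<^sub>R u)) has_derivative (\<lambda>h. H (h *\<^sub>R u))) (at 0)"
    by (rule has_derivative_compose) (use der in simp)
  then have "((\<lambda>t. G (z + t *\<^sub>R u) \<bullet> u) has_derivative (\<lambda>h. H (h *\<^sub>R u) \<bullet> u)) (at 0)"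
    by (rule has_derivative_inner_left)
  then have D2: "((\<lambda>t. G (z + t *\<^sub>R u) \<bullet> u) has_real_derivative (H u \<bullet> u)) (at 0)"
    by (simp add: has_field_derivative_def H.scaleR mult.commute[of _ "_ \<bullet> _"])
  show "H u \<bullet> u \<ge> 0"
  proof (rule ccontr)
    assume "\<not> H u \<bullet> u \<ge> 0"
    then obtain d' where d': "d' > 0" "\<And>h. 0 < h \<Longrightarrow> h < d' \<Longrightarrow> G (z + h *\<^sub>R u) \<bullet> u < 0"
      using DERIV_neg_dec_right[OF D2] G0 by auto
    define t where "t = min d d' / 2"
    have t: "0 < t" "t < d" "t < d'" using d d'(1) by (auto simp: t_def)
    obtain \<xi> where "0 < \<xi>" "\<xi> < t" "?\<phi> t - ?\<phi> 0 = (t - 0) * (G (z + \<xi> *\<^sub>R u) \<bullet> u)"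
      using MVT2[OF t(1), of ?\<phi> "\<lambda>x. G (z + x *\<^sub>R u) \<bullet> u"] D by blast
    moreover from this have "G (z + \<xi> *\<^sub>R u) \<bullet> u < 0" using d'(2) t by auto
    ultimately have "f (z + t *\<^sub>R u) < f z" using t(1) mult_pos_neg[of t] by fastforce
    then show False using min[of t] t by simp
  qed
qed

section \<open>Gradient and Hessian of a twice continuously differentiable function\<close>

lemma GDERIV_unique:
  assumes "GDERIV f z :> a" and "GDERIV f z :> b"
  shows "a = b"
proof -
  have "(\<lambda>h. h \<bullet> a) = (\<lambda>h. h \<bullet> b)"
    using assms unfolding gderiv_def by (rule has_derivative_unique)
  then show ?thesis by (metis vector_eq_rdot inner_commute)
qed

lemma gradient_eq: "GDERIV f z :> D \<Longrightarrow> gradient f z = D"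
  unfolding gradient_def by (blast intro: GDERIV_unique)

lemma C2_gradient:
  fixes f :: "real^'k \<Rightarrow> real"
  assumes "C2 f"
  shows "GDERIV f z :> gradient f z"
    and "(gradient f has_derivative (*v) (hessian f z)) (at z)"
proof -
  obtain f' :: "real^'k \<Rightarrow> (real^'k) \<Rightarrow>\<^sub>L real" where f': "\<And>z. (f has_derivative blinfun_apply (f' z)) (at z)"
    and "C1 f'" using assms unfolding C2_def by blast
  then obtain f'' where f'': "\<And>z. (f' has_derivative blinfun_apply (f'' z)) (at z)"
    unfolding C1_def by blast
  \<comment> \<open>The Riesz representative of \<open>f' z\<close>, written in the standard basis:
    its coefficients are evaluations of \<open>f' z\<close> at fixed vectors, so it inherits
    differentiability from \<open>f'\<close>.\<close>
  define G where "G z = (\<Sum>b\<in>Basis. blinfun_apply (f' z) b *\<^sub>R b)" for z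
  have "h \<bullet> G z = blinfun_apply (f' z) h" for h z
  proof -
    have "blinfun_apply (f' z) h = blinfun_apply (f' z) (\<Sum>b\<in>Basis. (h \<bullet> b) *\<^sub>R b)"
      by (simp add: euclidean_representation)
    also have "\<dots> = h \<bullet> G z"
      by (simp add: G_def blinfun.sum_right blinfun.scaleR_right inner_sum_right mult.commute)
    finally show ?thesis by simp
  qed
  then have GD: "GDERIV f z :> G z" for z using f'[of z] by (simp add: gderiv_def)
  then have eq: "gradient f = G" by (auto intro: gradient_eq)
  show "GDERIV f z :> gradient f z" using GD eq by simp
  have "f' differentiable (at z)" using f''[of z] by (auto simp: differentiable_def)
  then have "(\<lambda>z. blinfun_apply (f' z) b) differentiable (at z)" for b
    using bounded_linear.has_derivative[OF blinfun.bounded_linear_left]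
    unfolding differentiable_def by blast
  then have "G differentiable (at z)"
    unfolding G_def by (intro differentiable_sum differentiable_scaleR) auto
  then show "(gradient f has_derivative (*v) (hessian f z)) (at z)"
    unfolding hessian_def eq by (simp add: jacobian_works)
qed

section \<open>The block structure\<close>

text \<open>For \<open>\<tau> > 0\<close>, the factor \<open>1 / \<tau>\<close> gives multiplication
  by \<open>Lam \<tau>\<close>, the factor \<open>1 / sqrt \<tau>\<close> its square root, and
  \<open>sqrt \<tau>\<close> the inverse of that root.\<close>

definition scale_x :: "real \<Rightarrow> real^('n::finite + 'm::finite) \<Rightarrow> real^('n + 'm)" where
  "scale_x c z = join (c *\<^sub>R xpart z) (ypart z)"

text \<open>The sign change that turns the gradient of \<open>f\<close> into \<open>Fmap f\<close>;
  it is an isometric, self-adjoint involution.\<close>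

definition flip_y :: "real^('n::finite + 'm::finite) \<Rightarrow> real^('n + 'm)" where
  "flip_y z = join (xpart z) (- ypart z)"

lemma part_join [simp]: "xpart (join x y) = x" "ypart (join x y) = y"
  by (simp_all add: xpart_def ypart_def join_def vec_eq_iff)

lemma join_parts [simp]: "join (xpart z) (ypart z) = z"
  by (auto simp: xpart_def ypart_def join_def vec_eq_iff split: sum.split)

lemma linear_xpart: "linear xpart" and linear_ypart: "linear ypart"
  by (auto simp: xpart_def ypart_def vec_eq_iff intro!: linearI)

lemma join_add: "join (a + b) (c + d) = join a c + join b d"
  and join_scaleR: "join (r *\<^sub>R a) (r *\<^sub>R c) = r *\<^sub>R join a c"
  by (auto simp: join_def vec_eq_iff split: sum.split)

lemma inner_parts: "a \<bullet> b = xpart a \<bullet> xpart b + ypart a \<bullet> ypart b"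
proof -
  have "a \<bullet> b = (\<Sum>k\<in>range Inl. a $ k * b $ k) + (\<Sum>k\<in>range Inr. a $ k * b $ k)"
    unfolding inner_vec_def UNIV_sum by (subst sum.union_disjoint) auto
  then show ?thesis
    by (simp add: sum.reindex inner_vec_def xpart_def ypart_def)
qed

lemma linear_scale_x: "linear (scale_x c)"
  by (rule linearI)
    (simp_all add: scale_x_def linear_add[OF linear_xpart] linear_add[OF linear_ypart]
      linear_scale[OF linear_xpart] linear_scale[OF linear_ypart] scaleR_add_right
      join_add scaleR_left_commute[of c] join_scaleR del: scaleR_scaleR)

lemma linear_flip_y: "linear flip_y"
  by (rule linearI)
    (simp_all add: flip_y_def linear_add[OF linear_xpart] linear_add[OF linear_ypart]
      linear_scale[OF linear_xpart] linear_scale[OF linear_ypart] join_add[symmetric]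
      join_scaleR[symmetric])

lemma scale_x_scale_x: "scale_x a (scale_x b z) = scale_x (a * b) z"
  by (simp add: scale_x_def)

lemma scale_x_1: "scale_x 1 z = z"
  by (simp add: scale_x_def)

lemma flip_y_flip_y: "flip_y (flip_y z) = z"
  by (simp add: flip_y_def)

lemma inner_scale_x: "scale_x c a \<bullet> b = a \<bullet> scale_x c b"
  by (simp add: inner_parts[of "join _ _"] inner_parts[of a] scale_x_def)

lemma norm_scale_x_le: "norm (scale_x c z) \<le> max 1 \<bar>c\<bar> * norm z"
proof -
  have "(norm (scale_x c z))\<^sup>2 = c\<^sup>2 * (xpart z \<bullet> xpart z) + ypart z \<bullet> ypart z"
    unfolding power2_norm_eq_inner
    by (simp add: inner_parts[of "join _ _"] scale_x_def power2_eq_square)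
  also have "\<dots> \<le> (max 1 \<bar>c\<bar>)\<^sup>2 * (xpart z \<bullet> xpart z) + (max 1 \<bar>c\<bar>)\<^sup>2 * (ypart z \<bullet> ypart z)"
  proof (intro add_mono mult_right_mono)
    have "\<bar>c\<bar>\<^sup>2 \<le> (max 1 \<bar>c\<bar>)\<^sup>2" by (intro power_mono) auto
    then show "c\<^sup>2 \<le> (max 1 \<bar>c\<bar>)\<^sup>2" by simp
    have "1 \<le> (max 1 \<bar>c\<bar>)\<^sup>2" by (intro one_le_power) auto
    then show "ypart z \<bullet> ypart z \<le> (max 1 \<bar>c\<bar>)\<^sup>2 * (ypart z \<bullet> ypart z)"
      using mult_right_mono[of 1 _ "ypart z \<bullet> ypart z"] by simp
  qed auto
  also have "\<dots> = (max 1 \<bar>c\<bar> * norm z)\<^sup>2"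
    by (simp add: power_mult_distrib power2_norm_eq_inner inner_parts[of z] distrib_left)
  finally show ?thesis by (rule power2_le_imp_le) auto
qed

lemma norm_flip_y: "norm (flip_y z) = norm z"
  by (simp add: norm_eq_sqrt_inner inner_parts[of "join _ _"] inner_parts[of z] flip_y_def)

section \<open>The matrix \<Lambda> and the operator F in block form\<close>

lemma Lam_mult_vec: "Lam \<tau> *v z = scale_x (1 / \<tau>) z"
proof -
  have "(Lam \<tau> *v z) $ k = (case k of Inl _ \<Rightarrow> 1 / \<tau> | Inr _ \<Rightarrow> 1) * z $ k" for k
  proof -
    have "(Lam \<tau> *v z) $ k = (\<Sum>l\<in>UNIV. (if k = l then (case k of Inl _ \<Rightarrow> 1 / \<tau> | Inr _ \<Rightarrow> 1) * z $ k else 0))"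
      unfolding matrix_vector_mult_def Lam_def vec_lambda_beta by (rule sum.cong) auto
    then show ?thesis by simp
  qed
  then show ?thesis
    by (auto simp: vec_eq_iff scale_x_def join_def xpart_def ypart_def split: sum.split)
qed

text \<open>Each slice map is a linear embedding of one block plus a constant, so the chain rule
  gives the partial derivative as an inner product of \<open>D\<close> with a vector supported on
  that block.\<close>

lemma gradient_parts:
  assumes "GDERIV f z :> D"
  shows "gradient_x f z = xpart D" "gradient_y f z = ypart D"
proof -
  have l1: "linear (\<lambda>x. join x 0)" and l2: "linear (\<lambda>y. join 0 y)"
    by (auto simp: join_def vec_eq_iff intro!: linearI split: sum.split)
  have "((\<lambda>x. join x 0 + join 0 (ypart z)) has_derivative (\<lambda>h. join h 0 + 0)) (at (xpart z))"
    by (intro has_derivative_add linear_imp_has_derivative l1 has_derivative_const)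
  then have "((\<lambda>x. join x (ypart z)) has_derivative (\<lambda>h. join h 0)) (at (xpart z))"
    by (simp add: join_add[symmetric])
  then have "((\<lambda>x. f (join x (ypart z))) has_derivative (\<lambda>h. join h 0 \<bullet> D)) (at (xpart z))"
    by (rule has_derivative_compose) (use assms in \<open>simp add: gderiv_def\<close>)
  then have "GDERIV (\<lambda>x. f (join x (ypart z))) (xpart z) :> xpart D"
    by (simp add: gderiv_def inner_parts[of "join _ 0"])
  then show "gradient_x f z = xpart D" unfolding gradient_x_def by (rule gradient_eq)
  have "((\<lambda>y. join (xpart z) 0 + join 0 y) has_derivative (\<lambda>h. 0 + join 0 h)) (at (ypart z))"
    by (intro has_derivative_add linear_imp_has_derivative l2 has_derivative_const)
  then have "((\<lambda>y. join (xpart z) y) has_derivative (\<lambda>h. join 0 h)) (at (ypart z))"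
    by (simp add: join_add[symmetric])
  then have "((\<lambda>y. f (join (xpart z) y)) has_derivative (\<lambda>h. join 0 h \<bullet> D)) (at (ypart z))"
    by (rule has_derivative_compose) (use assms in \<open>simp add: gderiv_def\<close>)
  then have "GDERIV (\<lambda>y. f (join (xpart z) y)) (ypart z) :> ypart D"
    by (simp add: gderiv_def inner_parts[of "join 0 _"])
  then show "gradient_y f z = ypart D" unfolding gradient_y_def by (rule gradient_eq)
qed

lemma Fmap_eq_flip_gradient:
  assumes "C2 f"
  shows "Fmap f z = flip_y (gradient f z)"
  by (simp add: Fmap_def flip_y_def gradient_parts[OF C2_gradient(1)[OF assms]])

section \<open>Optimality conditions at a saddle point\<close>

lemma open_along_line:
  fixes z u :: "'a::real_normed_vector"
  assumes "open U" "z \<in> U"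
  shows "\<exists>d>0. \<forall>t. \<bar>t\<bar> < d \<longrightarrow> z + t *\<^sub>R u \<in> U"
proof -
  have "((\<lambda>t. z + t *\<^sub>R u) \<longlongrightarrow> z + 0 *\<^sub>R u) (at 0)" by (intro tendsto_intros)
  then have "eventually (\<lambda>t. z + t *\<^sub>R u \<in> U) (at 0)"
    by (rule topological_tendstoD) (use assms in auto)
  then obtain d where "d > 0" "\<And>t. t \<noteq> 0 \<Longrightarrow> \<bar>t\<bar> < d \<Longrightarrow> z + t *\<^sub>R u \<in> U"
    by (auto simp: eventually_at)
  then show ?thesis using assms(2)
    by (intro exI[of _ d]) (metis add.right_neutral scaleR_zero_left)
qed

text \<open>Along pure x-directions \<open>z\<close> is a local minimum and along pure y-directions
  a local maximum. For \<open>h = a + b\<close> split into blocks, moving \<open>flip_y\<close> to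
  the other factor pairs the Hessian at \<open>a + b\<close> with \<open>a - b\<close>; the cross
  terms cancel by symmetry, and the two remaining terms have the right signs.\<close>

lemma saddle_point_conditions:
  fixes f :: "real^('n::finite + 'm::finite) \<Rightarrow> real"
  assumes C2: "C2 f" and sp: "saddle_point f z"
  shows "gradient f z = 0" and "flip_y (hessian f z *v h) \<bullet> h \<ge> 0"
proof -
  note G = C2_gradient(1)[OF C2] and H = C2_gradient(2)[OF C2]
  obtain U where U: "open U" "z \<in> U"
    "\<And>x y. join x y \<in> U \<Longrightarrow> f (join (xpart z) y) \<le> f z \<and> f z \<le> f (join x (ypart z))"
    using sp unfolding saddle_point_def by blast
  have ex: "z + t *\<^sub>R join a 0 = join (xpart z + t *\<^sub>R a) (ypart z)" for t a
    using join_add[of "xpart z" "t *\<^sub>R a" "ypart z" 0] join_scaleR[of t a 0]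
    by (metis add.right_neutral join_parts scaleR_zero_right)
  have ey: "z + t *\<^sub>R join 0 b = join (xpart z) (ypart z + t *\<^sub>R b)" for t b
    using join_add[of "xpart z" 0 "ypart z" "t *\<^sub>R b"] join_scaleR[of t 0 b]
    by (metis add.right_neutral join_parts scaleR_zero_right)
  have x: "gradient f z \<bullet> join a 0 = 0" "(hessian f z *v join a 0) \<bullet> join a 0 \<ge> 0" for a
  proof -
    obtain d where d: "d > 0" "\<And>t. \<bar>t\<bar> < d \<Longrightarrow> z + t *\<^sub>R join a 0 \<in> U"
      using open_along_line[OF U(1,2)] by blast
    have "f z \<le> f (z + t *\<^sub>R join a 0)" if "\<bar>t\<bar> < d" for t
      using d(2)[OF that] U(3) by (simp add: ex)
    from local_min_along_line_conditions[OF G H d(1) this]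
    show "gradient f z \<bullet> join a 0 = 0" "(hessian f z *v join a 0) \<bullet> join a 0 \<ge> 0" by auto
  qed
  have y: "gradient f z \<bullet> join 0 b = 0" "(hessian f z *v join 0 b) \<bullet> join 0 b \<le> 0" for b
  proof -
    obtain d where d: "d > 0" "\<And>t. \<bar>t\<bar> < d \<Longrightarrow> z + t *\<^sub>R join 0 b \<in> U"
      using open_along_line[OF U(1,2)] by blast
    \<comment> \<open>The maximum in y is treated as a minimum of \<open>- f\<close>.\<close>
    have "- f z \<le> - f (z + t *\<^sub>R join 0 b)" if "\<bar>t\<bar> < d" for t
      using d(2)[OF that] U(3) by (simp add: ey)
    from local_min_along_line_conditions[OF GDERIV_minus[OF G] has_derivative_minus[OF H] d(1) this]
    show "gradient f z \<bullet> join 0 b = 0" "(hessian f z *v join 0 b) \<bullet> join 0 b \<le> 0" by auto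
  qed
  have split: "h = join (xpart h) 0 + join 0 (ypart h)" for h :: "real^('n + 'm)"
    by (simp add: join_add[symmetric])
  have "gradient f z \<bullet> h = 0" for h
    using x(1)[of "xpart h"] y(1)[of "ypart h"] by (subst split[of h]) (simp add: inner_add_right)
  then show "gradient f z = 0" by (metis inner_eq_zero_iff)
  define a b where "a = join (xpart h) (0 :: real^'m)" and "b = join (0 :: real^'n) (ypart h)"
  have hab: "h = a + b" unfolding a_def b_def by (rule split)
  have "flip_y (hessian f z *v h) \<bullet> h = (hessian f z *v h) \<bullet> (a - b)"
  proof -
    have "a - b = flip_y h" unfolding a_def b_def flip_y_def
      using join_add[of "xpart h" 0 0 "- ypart h"] join_scaleR[of "-1" 0 "ypart h"]
      by (metis add_0 add.right_neutral minus_zero scaleR_minus1_left uminus_add_conv_diff add.commute)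
    then show ?thesis
      by (simp add: inner_parts[of "join _ _"] inner_parts[of _ "join _ _"] flip_y_def)
  qed
  also have "\<dots> = (hessian f z *v a) \<bullet> a - (hessian f z *v b) \<bullet> b"
    using derivative_of_gradient_symmetric[OF G H, of z a b]
    by (simp add: hab matrix_vector_right_distrib inner_add_left inner_diff_right)
  finally show "flip_y (hessian f z *v h) \<bullet> h \<ge> 0"
    using x(2)[of "xpart h"] y(2)[of "ypart h"] by (simp add: a_def b_def)
qed

section \<open>Contraction and stability\<close>

text \<open>With \<open>y = x - s *\<^sub>R S x\<close>, monotonicity at \<open>y\<close> makes
  \<open>S y \<bullet> x\<close> at least about s times the squared norm of \<open>S x\<close>. The
  decrease from the cross term is then of the same order in s as the increase from the squared step,
  and it wins because \<open>\<gamma> < 2\<close>. The lower bound \<open>\<sigma>\<close> converts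
  this gain into a multiple of the squared norm of \<open>x\<close>; it affects the rate
  \<open>q\<close> but not the condition on \<open>s\<close>.\<close>

lemma extragradient_strict_contraction:
  fixes S :: "'a::real_inner \<Rightarrow> 'a"
  assumes "linear S" and mono: "\<And>x. S x \<bullet> x \<ge> 0"
    and K: "\<And>x. norm (S x) \<le> K * norm x" and "K \<ge> 0"
    and \<sigma>: "\<sigma> > 0" "\<And>x. \<sigma> * norm x \<le> norm (S x)"
    and \<gamma>: "0 < \<gamma>" "\<gamma> < 2" and s: "s > 0" "s * K < (2 - \<gamma>) / 8"
  shows "\<exists>q\<ge>0. q < 1 \<and> (\<forall>x. norm (x - (\<gamma> * s) *\<^sub>R S (x - s *\<^sub>R S x)) \<le> q * norm x)"
proof -
  define u where "u = s * K"
  have u: "0 \<le> u" "u < 1" "8 * u < 2 - \<gamma>" using assms by (auto simp: u_def)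
  \<comment> \<open>The gain coefficient. From \<open>u * u \<le> u\<close> and
    \<open>\<gamma> * u \<le> 2 * u\<close> it is at least \<open>2 - \<gamma> - 8 * u\<close>,
    which explains the 8 in the condition on \<open>s\<close>.\<close>
  define c where "c = 2 * (1 - u) - \<gamma> * (1 + u)\<^sup>2"
  have "u * u \<le> u" using u by (simp add: mult_left_le)
  then have "\<gamma> * (1 + u)\<^sup>2 \<le> \<gamma> * (1 + 3 * u)"
    using \<gamma> by (intro mult_left_mono) (auto simp: power2_eq_square algebra_simps)
  moreover have "\<gamma> * u \<le> 2 * u" using \<gamma> u by (intro mult_right_mono) auto
  ultimately have c: "c > 0" using u by (simp add: c_def algebra_simps)
  define \<eta> where "\<eta> = \<gamma> * s\<^sup>2 * c * \<sigma>\<^sup>2"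
  have \<eta>: "\<eta> > 0" using \<gamma> s c \<sigma> by (simp add: \<eta>_def)
  \<comment> \<open>The \<open>max\<close> makes \<open>q\<close> nonnegative without an upper bound
    on \<open>\<eta>\<close>.\<close>
  define q where "q = sqrt (max 0 (1 - \<eta>))"
  have "norm (x - (\<gamma> * s) *\<^sub>R S (x - s *\<^sub>R S x)) \<le> q * norm x" for x
  proof -
    define y where "y = x - s *\<^sub>R S x"
    have Sy: "S y - S x = - (s *\<^sub>R S (S x))"
      unfolding y_def linear_diff[OF \<open>linear S\<close>] linear_scale[OF \<open>linear S\<close>] by simp
    have d: "norm (S y - S x) \<le> u * norm (S x)"
      unfolding Sy using K[of "S x"] s by (simp add: u_def mult_left_mono mult.assoc)
    have n: "(norm (S y))\<^sup>2 \<le> (1 + u)\<^sup>2 * (norm (S x))\<^sup>2"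
    proof -
      have "norm (S y) \<le> (1 + u) * norm (S x)"
        using norm_triangle_ineq[of "S x" "S y - S x"] d by (simp add: algebra_simps)
      then show ?thesis using power_mono[of _ _ 2] by (fastforce simp: power_mult_distrib)
    qed
    have i: "S y \<bullet> S x \<ge> (1 - u) * (norm (S x))\<^sup>2"
    proof -
      have "\<bar>(S y - S x) \<bullet> S x\<bar> \<le> norm (S y - S x) * norm (S x)" by (rule Cauchy_Schwarz_ineq2)
      also have "\<dots> \<le> u * norm (S x) * norm (S x)" using d by (intro mult_right_mono) auto
      finally have "\<bar>(S y - S x) \<bullet> S x\<bar> \<le> u * (norm (S x))\<^sup>2"
        by (simp add: power2_eq_square mult.assoc)
      then show ?thesis by (simp add: inner_diff_left power2_norm_eq_inner algebra_simps)
    qed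
    \<comment> \<open>Substituting \<open>x = y + s *\<^sub>R S x\<close> isolates
      \<open>S y \<bullet> y\<close>, whose sign is known.\<close>
    have "S y \<bullet> x = S y \<bullet> y + s * (S y \<bullet> S x)" by (simp add: y_def inner_diff_right)
    then have "S y \<bullet> x \<ge> s * (S y \<bullet> S x)" using mono[of y] by simp
    also have "s * (S y \<bullet> S x) \<ge> s * ((1 - u) * (norm (S x))\<^sup>2)" using i s by (intro mult_left_mono) auto
    finally have j: "S y \<bullet> x \<ge> s * ((1 - u) * (norm (S x))\<^sup>2)" .
    have "(norm (x - (\<gamma> * s) *\<^sub>R S y))\<^sup>2 = (norm x)\<^sup>2 - 2 * (\<gamma> * s) * (S y \<bullet> x) + (\<gamma> * s)\<^sup>2 * (norm (S y))\<^sup>2"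
      by (simp only: power2_norm_eq_inner)
        (simp add: inner_diff_left inner_diff_right inner_commute power2_eq_square algebra_simps)
    also have "\<dots> \<le> (norm x)\<^sup>2 - 2 * (\<gamma> * s) * (s * ((1 - u) * (norm (S x))\<^sup>2))
        + (\<gamma> * s)\<^sup>2 * ((1 + u)\<^sup>2 * (norm (S x))\<^sup>2)"
      using j n \<gamma> s by (intro add_mono diff_mono mult_left_mono) auto
    also have "\<dots> = (norm x)\<^sup>2 - \<gamma> * s\<^sup>2 * c * (norm (S x))\<^sup>2"
      by (simp add: c_def power2_eq_square algebra_simps)
    also have "\<dots> \<le> (norm x)\<^sup>2 - \<gamma> * s\<^sup>2 * c * (\<sigma> * norm x)\<^sup>2"
      using \<gamma> s c \<sigma> by (intro diff_mono mult_left_mono power_mono) auto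
    also have "\<dots> = (1 - \<eta>) * (norm x)\<^sup>2" by (simp add: \<eta>_def power_mult_distrib algebra_simps)
    also have "\<dots> \<le> max 0 (1 - \<eta>) * (norm x)\<^sup>2" by (intro mult_right_mono) auto
    also have "\<dots> = (q * norm x)\<^sup>2" by (simp add: q_def power_mult_distrib)
    finally show ?thesis unfolding y_def by (rule power2_le_imp_le) (simp add: q_def)
  qed
  moreover have "0 \<le> q" "q < 1" using \<eta> by (auto simp: q_def)
  ultimately show ?thesis by blast
qed

text \<open>Linearised stability in an adapted norm: the derivative contracts the norm of
  \<open>T x\<close>, which is equivalent to the given norm with constants \<open>c\<close> and
  \<open>C\<close>. Near \<open>ze\<close> the nonlinear remainder uses up only half of the gap
  \<open>1 - q\<close>, so the map itself contracts at the intermediate rate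
  \<open>p\<close>.\<close>

lemma exp_stable_equilibriumI:
  fixes w :: "'a::real_normed_vector \<Rightarrow> 'a" and T :: "'a \<Rightarrow> 'b::real_normed_vector"
  assumes fix_pt: "w ze = ze" and der: "(w has_derivative A) (at ze)" and "linear T"
    and q: "0 \<le> q" "q < 1" "\<And>x. norm (T (A x)) \<le> q * norm (T x)"
    and c: "c > 0" "\<And>x. c * norm x \<le> norm (T x)"
    and C: "\<And>x. norm (T x) \<le> C * norm x" "C > 0"
  shows "exp_stable_equilibrium w ze"
proof -
  define p where "p = (1 + q) / 2"
  have p: "0 < p" "p < 1" using q by (auto simp: p_def)
  \<comment> \<open>Passing the remainder through \<open>T\<close> costs a factor \<open>C\<close>,
    and returning to the norm of \<open>T (y - ze)\<close> costs \<open>1 / c\<close>; what remains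
    is \<open>(1 - q) / 2\<close>.\<close>
  define e where "e = (1 - q) / 2 * c / C"
  have e: "e > 0" using q c C by (simp add: e_def)
  obtain d where d: "d > 0"
    "\<And>y. norm (y - ze) < d \<Longrightarrow> norm (w y - w ze - A (y - ze)) \<le> e * norm (y - ze)"
    using der e unfolding has_derivative_at_alt by blast
  have step: "norm (T (w y - ze)) \<le> p * norm (T (y - ze))" if "norm (y - ze) < d" for y
  proof -
    let ?r = "w y - ze - A (y - ze)"
    have "norm (T ?r) \<le> C * (e * norm (y - ze))"
      using C(1)[of ?r] mult_left_mono[OF d(2)[OF that], of C] C(2) unfolding fix_pt by linarith
    also have "\<dots> = (1 - q) / 2 * (c * norm (y - ze))" using C(2) by (simp add: e_def)
    also have "\<dots> \<le> (1 - q) / 2 * norm (T (y - ze))"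
      using q by (intro mult_left_mono c(2)) auto
    finally have r: "norm (T ?r) \<le> (1 - q) / 2 * norm (T (y - ze))" .
    have "T (w y - ze) = T (A (y - ze)) + T ?r"
      by (simp add: linear_add[OF \<open>linear T\<close>, symmetric])
    then have "norm (T (w y - ze)) \<le> norm (T (A (y - ze))) + norm (T ?r)"
      by (simp add: norm_triangle_ineq)
    also have "\<dots> \<le> q * norm (T (y - ze)) + (1 - q) / 2 * norm (T (y - ze))"
      using q(3) r by (intro add_mono)
    finally show ?thesis by (simp add: p_def field_simps)
  qed
  define M where "M = C / c"
  have M: "M > 0" using C c by (simp add: M_def)
  have iter: "norm ((w ^^ k) z0 - ze) \<le> M * norm (z0 - ze) * p ^ k"
    if z0: "norm (z0 - ze) < d / M" for z0 k
  proof -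
    have unweight: "norm ((w ^^ k) z0 - ze) \<le> M * norm (z0 - ze) * p ^ k"
      if "norm (T ((w ^^ k) z0 - ze)) \<le> p ^ k * norm (T (z0 - ze))" for k
    proof -
      have "c * norm ((w ^^ k) z0 - ze) \<le> p ^ k * norm (T (z0 - ze))"
        using c(2) that by (rule order_trans)
      also have "\<dots> \<le> p ^ k * (C * norm (z0 - ze))"
        using p by (intro mult_left_mono C(1)) auto
      finally have "c * norm ((w ^^ k) z0 - ze) \<le> p ^ k * (C * norm (z0 - ze))" .
      then show ?thesis using c(1) by (simp add: M_def field_simps)
    qed
    \<comment> \<open>The induction runs in the \<open>T\<close>-norm so that no constant
      accumulates. At each step \<open>unweight\<close> pays the factor \<open>M\<close> once, and
      the starting radius \<open>d / M\<close> keeps the iterate within \<open>d\<close>, where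
      \<open>step\<close> applies.\<close>
    have "norm (T ((w ^^ k) z0 - ze)) \<le> p ^ k * norm (T (z0 - ze))"
    proof (induction k)
      case (Suc k)
      have "norm ((w ^^ k) z0 - ze) \<le> M * norm (z0 - ze) * p ^ k" using unweight Suc by simp
      also have "\<dots> \<le> M * norm (z0 - ze) * 1"
        using M p by (intro mult_left_mono power_le_one) auto
      also have "\<dots> < d" using z0 M by (simp add: field_simps)
      finally have "norm (T (w ((w ^^ k) z0) - ze)) \<le> p * norm (T ((w ^^ k) z0 - ze))"
        by (rule step)
      also have "\<dots> \<le> p * (p ^ k * norm (T (z0 - ze)))" using Suc p by (intro mult_left_mono) auto
      finally show ?case by (simp add: mult.assoc)
    qed simp
    then show ?thesis by (rule unweight)
  qed
  have "stable_equilibrium w ze"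
    unfolding stable_equilibrium_def
  proof (intro conjI allI impI fix_pt)
    fix \<epsilon> :: real assume \<epsilon>: "\<epsilon> > 0"
    show "\<exists>\<delta>>0. \<forall>z0. norm (z0 - ze) < \<delta> \<longrightarrow> (\<forall>k. norm ((w ^^ k) z0 - ze) < \<epsilon>)"
    proof (intro exI[of _ "min d \<epsilon> / M"] conjI allI impI)
      show "min d \<epsilon> / M > 0" using d M \<epsilon> by simp
      fix z0 k assume z0: "norm (z0 - ze) < min d \<epsilon> / M"
      have "norm (z0 - ze) < d / M" using z0 M by (simp add: field_simps)
      then have "norm ((w ^^ k) z0 - ze) \<le> M * norm (z0 - ze) * p ^ k" by (rule iter)
      also have "\<dots> \<le> M * norm (z0 - ze) * 1"
        using M p by (intro mult_left_mono power_le_one) auto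
      also have "\<dots> < \<epsilon>" using z0 M by (simp add: field_simps)
      finally show "norm ((w ^^ k) z0 - ze) < \<epsilon>" .
    qed
  qed
  moreover have "d / M > 0" using d M by simp
  ultimately show ?thesis
    unfolding exp_stable_equilibrium_def using iter M p by (metis greaterThanLessThan_iff)
qed

text \<open>Conjugating the derivative of the method by \<open>?T\<close> replaces
  \<open>?\<Lambda>\<close> after \<open>J\<close> by the two-sided scaling \<open>S\<close>. Unlike
  that product, \<open>S\<close> visibly inherits monotonicity from \<open>J\<close>, so the
  contraction lemma applies.\<close>

lemma gen_extragradient_exp_stable_at_saddle_point:
  fixes f :: "real^('n::finite + 'm::finite) \<Rightarrow> real"
  assumes C2: "C2 f" and L: "L-lipschitz_on UNIV (gradient f)"
    and sp: "saddle_point f z" and inv: "invertible (hessian f z)"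
    and \<tau>: "\<tau> > 0" and \<gamma>: "0 < \<gamma>" "\<gamma> < 2"
    and s: "s > 0" "s * ((max 1 (1 / sqrt \<tau>))\<^sup>2 * L) < (2 - \<gamma>) / 8"
  shows "exp_stable_equilibrium (gen_extragradient f \<tau> \<gamma> s) z"
proof -
  let ?F = "\<lambda>z. flip_y (gradient f z)"
  let ?D = "scale_x (1 / sqrt \<tau>) :: real^('n + 'm) \<Rightarrow> real^('n + 'm)"
  let ?T = "scale_x (sqrt \<tau>) :: real^('n + 'm) \<Rightarrow> real^('n + 'm)"
  let ?\<Lambda> = "scale_x (1 / \<tau>) :: real^('n + 'm) \<Rightarrow> real^('n + 'm)"
  define J where "J h = flip_y (hessian f z *v h)" for h
  define S where "S x = ?D (J (?D x))" for x
  define m where "m = max 1 (1 / sqrt \<tau>)"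
  note H = C2_gradient(2)[OF C2, of z]
  have L0: "L \<ge> 0" using L by (rule lipschitz_on_nonneg)
  have m: "m \<ge> 1" by (simp add: m_def)
  have w: "gen_extragradient f \<tau> \<gamma> s = (\<lambda>z. z - (\<gamma> * s) *\<^sub>R ?\<Lambda> (?F (z - s *\<^sub>R ?\<Lambda> (?F z))))"
    by (auto simp: gen_extragradient_def Lam_mult_vec Fmap_eq_flip_gradient[OF C2])
  have F0: "?F z = 0" using saddle_point_conditions(1)[OF C2 sp] by (simp add: linear_0[OF linear_flip_y])
  have \<Lambda>0: "?\<Lambda> 0 = 0" by (simp add: linear_0[OF linear_scale_x])
  have linJ: "linear J" unfolding J_def
    using linear_compose[OF matrix_vector_mul_linear linear_flip_y] by (simp add: o_def)
  have linS: "linear S" unfolding S_def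
    using linear_compose[OF linear_compose[OF linear_scale_x linJ] linear_scale_x] by (simp add: o_def)
  have D\<Lambda>: "bounded_linear ?\<Lambda>" and bflip: "bounded_linear (flip_y :: real^('n + 'm) \<Rightarrow> real^('n + 'm))"
    using linear_scale_x linear_flip_y by (auto simp: linear_conv_bounded_linear)
  have dF: "(?F has_derivative J) (at z)"
    unfolding J_def by (rule bounded_linear.has_derivative[OF bflip H])
  have d1: "((\<lambda>z. z - s *\<^sub>R ?\<Lambda> (?F z)) has_derivative (\<lambda>h. h - s *\<^sub>R ?\<Lambda> (J h))) (at z)"
    by (intro has_derivative_diff has_derivative_ident has_derivative_scaleR_right
        bounded_linear.has_derivative[OF D\<Lambda>] dF)
  \<comment> \<open>Since F vanishes at \<open>z\<close>, the inner step fixes \<open>z\<close>, and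
    both occurrences of F are differentiated at the same point.\<close>
  have d2: "((\<lambda>z. ?F (z - s *\<^sub>R ?\<Lambda> (?F z))) has_derivative (\<lambda>h. J (h - s *\<^sub>R ?\<Lambda> (J h)))) (at z)"
    by (rule has_derivative_compose[OF d1]) (use dF in \<open>simp add: F0 \<Lambda>0\<close>)
  have dw: "(gen_extragradient f \<tau> \<gamma> s has_derivative
      (\<lambda>h. h - (\<gamma> * s) *\<^sub>R ?\<Lambda> (J (h - s *\<^sub>R ?\<Lambda> (J h))))) (at z)"
    unfolding w
    by (intro has_derivative_diff has_derivative_ident has_derivative_scaleR_right
        bounded_linear.has_derivative[OF D\<Lambda>] d2)
  have TD: "?T (?D x) = x" "?D (?T x) = x" for x
    using \<tau> by (simp_all add: scale_x_scale_x scale_x_1)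
  have T\<Lambda>: "?T (?\<Lambda> (J x)) = S (?T x)" for x
  proof -
    have "sqrt \<tau> * (1 / \<tau>) = 1 / sqrt \<tau>" using \<tau> by (simp add: field_simps)
    then show ?thesis by (simp only: S_def TD scale_x_scale_x[of "sqrt \<tau>" "1 / \<tau>"])
  qed
  have mono: "S x \<bullet> x \<ge> 0" for x
    unfolding S_def inner_scale_x using saddle_point_conditions(2)[OF C2 sp] by (simp add: J_def)
  have nD: "norm (?D x) \<le> m * norm x" for x
    using norm_scale_x_le[of "1 / sqrt \<tau>" x] \<tau> by (simp add: m_def)
  have K: "norm (S x) \<le> m\<^sup>2 * L * norm x" for x
  proof -
    have "norm (S x) \<le> m * norm (J (?D x))" unfolding S_def by (rule nD)
    also have "\<dots> \<le> m * (L * norm (?D x))"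
      unfolding J_def norm_flip_y using m
      by (intro mult_left_mono has_derivative_norm_le_lipschitz[OF L H]) auto
    also have "\<dots> \<le> m * (L * (m * norm x))"
      using m L0 by (intro mult_left_mono nD) auto
    finally show ?thesis by (simp add: power2_eq_square algebra_simps)
  qed
  \<comment> \<open>Invertibility of the Hessian enters here; in finite dimension injectivity yields
    the lower bound \<open>\<sigma>\<close>, which may depend on \<open>z\<close>.\<close>
  have "inj S"
  proof (rule injI)
    fix x y assume "S x = S y"
    then have "?T (S x) = ?T (S y)" by simp
    then have "flip_y (J (?D x)) = flip_y (J (?D y))" by (simp add: S_def TD)
    then have "hessian f z *v ?D x = hessian f z *v ?D y" by (simp add: J_def flip_y_flip_y)
    then have "?D x = ?D y"
      using inv by (auto dest: injD simp: invertible_left_inverse matrix_left_invertible_injective)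
    then show "x = y" using TD(1) by metis
  qed
  then obtain \<sigma> where \<sigma>: "\<sigma> > 0" "\<And>x. \<sigma> * norm x \<le> norm (S x)"
    using linear_inj_bounded_below_pos[OF linS] by auto
  obtain q where q: "q \<ge> 0" "q < 1" "\<And>x. norm (x - (\<gamma> * s) *\<^sub>R S (x - s *\<^sub>R S x)) \<le> q * norm x"
    using extragradient_strict_contraction[OF linS mono K _ \<sigma> \<gamma> s(1)] s(2) L0
    by (auto simp: m_def)
  show ?thesis
  proof (rule exp_stable_equilibriumI[OF _ dw linear_scale_x q(1,2)])
    show "gen_extragradient f \<tau> \<gamma> s z = z" by (simp add: w F0 \<Lambda>0)
    fix x
    show "norm (?T (x - (\<gamma> * s) *\<^sub>R ?\<Lambda> (J (x - s *\<^sub>R ?\<Lambda> (J x))))) \<le> q * norm (?T x)"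
      using q(3)[of "?T x"]
      by (simp add: linear_diff[OF linear_scale_x] linear_scale[OF linear_scale_x] T\<Lambda>)
    show "1 / m * norm x \<le> norm (?T x)"
      using nD[of "?T x"] m by (simp add: TD field_simps)
    show "norm (?T x) \<le> max 1 (sqrt \<tau>) * norm x"
      using norm_scale_x_le[of "sqrt \<tau>" x] \<tau> by simp
  qed (use m in auto)
qed

theorem corollary4p7:
  fixes f :: "real^('n::finite + 'm::finite) \<Rightarrow> real" and L \<tau> \<gamma> :: real
  assumes "C2 f"
    and "L > 0" and "L-lipschitz_on UNIV (gradient f)"
    and "\<And>z. saddle_point f z \<Longrightarrow> invertible (hessian f z)"
    and "\<tau> > 0" and "0 < \<gamma>" and "\<gamma> < 2"
    and "\<And>s. s > 0 \<Longrightarrow> C1 (gen_extragradient f \<tau> \<gamma> s)"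
    and "\<And>s. s > 0 \<Longrightarrow> C1 (extragradient_resolution_field f \<tau> \<gamma> s)"
    and "\<exists>r\<ge>2. one_step_consistent r (gen_extragradient f \<tau> \<gamma>) (extragradient_resolution_field f \<tau> \<gamma>)"
  shows "\<exists>s_star>0. \<forall>s\<in>{0<..<s_star}.
    {z. saddle_point f z} \<subseteq> {z. exp_stable_equilibrium (gen_extragradient f \<tau> \<gamma> s) z}"
proof -
  define K where "K = (max 1 (1 / sqrt \<tau>))\<^sup>2 * L"
  have "max 1 (1 / sqrt \<tau>) > 0" by (rule less_le_trans[of _ 1]) auto
  then have K: "K > 0" using assms(2) by (simp add: K_def)
  show ?thesis
  \<comment> \<open>This is the bound \<open>s * K < (2 - \<gamma>) / 8\<close> solved for
    \<open>s\<close>. As \<open>K\<close> involves only \<open>L\<close> and \<open>\<tau>\<close>,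
    one threshold serves all saddle points, even infinitely many.\<close>
  proof (intro exI[of _ "(2 - \<gamma>) / 8 / K"] conjI ballI subsetI)
    show "(2 - \<gamma>) / 8 / K > 0" using K assms(7) by simp
    fix s z assume s: "s \<in> {0<..<(2 - \<gamma>) / 8 / K}" and z: "z \<in> {z. saddle_point f z}"
    have "s * K < (2 - \<gamma>) / 8" using s K pos_less_divide_eq[of K s "(2 - \<gamma>) / 8"] by simp
    then show "z \<in> {z. exp_stable_equilibrium (gen_extragradient f \<tau> \<gamma> s) z}"
      using gen_extragradient_exp_stable_at_saddle_point[OF assms(1,3) _ assms(4) assms(5-7)] s z
      by (auto simp: K_def)
  qed
qed

end
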